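(* Let $n\ge 2$ and let $u=u^*\in\mathbb C[\mathbb F_n]$ satisfy $\tau(u)=0$. Write $$u=\sum_{k\ge1}u_k,\qquad u_k\in H_k,$$ and put $b_k=\|u_k\|_2$. Define $S,Q\ge0$ by $$S^2=\sum_{k\ge1}b_k^2,\qquad Q^2=\sum_{k\ge1}(k-1)b_k^2.$$ Then $$|\tau(u^3)|\le 3S^2Q+Q^3.$$
   Context: $\mathbb F_n$ is the free group on $n$ generators, with $|g|$ the reduced word length of $g$. $\lambda$ is the left regular representation of $\mathbb F_n$ on $\ell_2(\mathbb F_n)$, and $\widehat{\mathbb F_n}$ is the von Neumann algebra it generates, with canonical tracial state $\tau(\lambda_g)=\delta_{g,e}$. $\mathbb C[\mathbb F_n]=\operatorname{span}\{\lambda_g:g\in\mathbb F_n\}$, and $\|x\|_2=\tau(x^*x)^{1/2}$. For $k\ge0$, $H_k=\operatorname{span}\{\lambda_g:\ |g|=k\}$; these are mutually orthogonal in $L_2(\widehat{\mathbb F_n})$, and the (finite) decomposition of $u$ is the orthogonal one, $u_k$ being the projection of $u$ onto $H_k$. *)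

theory Defs
  imports
    "HOL-Algebra.Group"
    "HOL-Analysis.Infinite_Sum"
    "HOL-Library.Function_Algebras"
begin

section \<open>The free group on \<open>n\<close> generators\<close>

text \<open>A letter \<open>(i, True)\<close> stands for the generator \<open>i\<close> and \<open>(i, False)\<close> for its inverse.
  Group elements are reduced words, so the reduced word length is \<^const>\<open>length\<close>.\<close>

type_synonym letter = "nat \<times> bool"
type_synonym gen_word = "letter list"

definition inv_letter :: "letter \<Rightarrow> letter"
  where "inv_letter x = (fst x, \<not> snd x)"

definition reduced :: "gen_word \<Rightarrow> bool"
  where "reduced = successively (\<lambda>x y. y \<noteq> inv_letter x)"

fun cons_reduce :: "letter \<Rightarrow> gen_word \<Rightarrow> gen_word"
  where
    "cons_reduce x [] = [x]"
  | "cons_reduce x (y # w) = (if y = inv_letter x then w else x # y # w)"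

definition free_group :: "nat \<Rightarrow> gen_word monoid"
  where "free_group n =
    \<lparr>carrier = {w. set w \<subseteq> {..<n} \<times> UNIV \<and> reduced w},
     monoid.mult = (\<lambda>v w. foldr cons_reduce v w),
     one = []\<rparr>"

lemma inv_letter_simps [simp]:
  "inv_letter (inv_letter x) = x" "inv_letter x \<noteq> x" "x \<noteq> inv_letter x"
  "fst (inv_letter x) = fst x"
  by (auto simp: inv_letter_def prod_eq_iff)

lemma reduced_simps [simp]:
  "reduced []" "reduced [x]"
  "reduced (x # y # w) \<longleftrightarrow> y \<noteq> inv_letter x \<and> reduced (y # w)"
  by (auto simp: reduced_def)

lemma reduced_tl: "reduced (x # w) \<Longrightarrow> reduced w"
  by (cases w) auto

lemma cons_reduce_eq_Cons: "reduced (x # w) \<Longrightarrow> cons_reduce x w = x # w"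
  by (cases w) auto

lemma reduced_cons_reduce: "reduced w \<Longrightarrow> reduced (cons_reduce x w)"
  by (cases w) (auto dest: reduced_tl)

lemma reduced_foldr: "reduced w \<Longrightarrow> reduced (foldr cons_reduce v w)"
  by (induction v) (auto intro: reduced_cons_reduce)

lemma cons_reduce_cancel: "reduced w \<Longrightarrow> cons_reduce x (cons_reduce (inv_letter x) w) = w"
  by (cases w) (auto simp: cons_reduce_eq_Cons)

lemma set_cons_reduce: "set (cons_reduce x w) \<subseteq> insert x (set w)"
  by (cases w) auto

lemma set_foldr_cons_reduce: "set (foldr cons_reduce v w) \<subseteq> set v \<union> set w"
  by (induction v) (use set_cons_reduce in fastforce)+

lemma foldr_cons_reduce_assoc_step:
  assumes "reduced w" "reduced z"
  shows "foldr cons_reduce (cons_reduce x w) z = cons_reduce x (foldr cons_reduce w z)"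
  using assms
  by (cases w) (auto simp: cons_reduce_cancel reduced_foldr)

lemma foldr_cons_reduce_assoc:
  assumes "reduced w" "reduced z"
  shows "foldr cons_reduce (foldr cons_reduce v w) z
    = foldr cons_reduce v (foldr cons_reduce w z)"
  using assms
  by (induction v) (auto simp: foldr_cons_reduce_assoc_step reduced_foldr)

lemma foldr_cons_reduce_Nil: "reduced v \<Longrightarrow> foldr cons_reduce v [] = v"
  by (induction v) (simp_all add: cons_reduce_eq_Cons reduced_tl)

lemma foldr_cons_reduce_inverse:
  assumes "reduced z"
  shows "foldr cons_reduce (rev (map inv_letter v)) (foldr cons_reduce v z) = z"
  using assms
proof (induction v)
  case (Cons x v)
  then show ?case
    using cons_reduce_cancel[of "foldr cons_reduce v z" "inv_letter x"]
    by (simp add: reduced_foldr)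
qed simp

lemma reduced_append_single:
  "reduced (w @ [x]) \<longleftrightarrow> reduced w \<and> (w = [] \<or> x \<noteq> inv_letter (last w))"
  by (induction w rule: induct_list012) auto

lemma reduced_inverse: "reduced v \<Longrightarrow> reduced (rev (map inv_letter v))"
proof (induction v)
  case (Cons x v)
  have "reduced (rev (map inv_letter v))"
    using Cons reduced_tl by blast
  moreover have "v = [] \<or> inv_letter x \<noteq> hd v"
    using Cons.prems by (cases v) auto
  ultimately show ?case
    by (auto simp: reduced_append_single last_rev hd_map)
qed simp

lemma group_free_group: "group (free_group n)"
proof (rule groupI)
  fix x assume x: "x \<in> carrier (free_group n)"
  let ?y = "rev (map inv_letter x)"
  have "?y \<in> carrier (free_group n)"
    using x by (fastforce simp: free_group_def reduced_inverse inv_letter_def)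
  moreover have "?y \<otimes>\<^bsub>free_group n\<^esub> x = \<one>\<^bsub>free_group n\<^esub>"
    using x foldr_cons_reduce_inverse[of "[]" x]
    by (simp add: free_group_def foldr_cons_reduce_Nil)
  ultimately show "\<exists>y \<in> carrier (free_group n). y \<otimes>\<^bsub>free_group n\<^esub> x = \<one>\<^bsub>free_group n\<^esub>"
    by blast
next
  fix x y assume "x \<in> carrier (free_group n)" "y \<in> carrier (free_group n)"
  then show "x \<otimes>\<^bsub>free_group n\<^esub> y \<in> carrier (free_group n)"
    using set_foldr_cons_reduce[of x y] by (auto simp: free_group_def reduced_foldr)
qed (auto simp: free_group_def foldr_cons_reduce_assoc)


section \<open>The left regular representation and the group algebra\<close>

text \<open>Vectors of \<open>\<ell>\<^sub>2(G)\<close> are functions vanishing off the carrier, and operators on \<open>\<ell>\<^sub>2(G)\<close> are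
  HOL functions taking the value \<open>0\<close> off \<open>\<ell>\<^sub>2(G)\<close>; with these conventions equality of
  operators is equality of HOL functions. Sums and differences of operators are the pointwise ones
  of \<^theory>\<open>HOL-Library.Function_Algebras\<close>, but the product of operators is composition, so powers
  are written \<open>u ^^ m\<close>, not \<open>u ^ m\<close>.\<close>

type_synonym 'g operator = "('g \<Rightarrow> complex) \<Rightarrow> ('g \<Rightarrow> complex)"

definition ell2 :: "('g, 'm) monoid_scheme \<Rightarrow> ('g \<Rightarrow> complex) set"
  where "ell2 G = {f. (\<forall>h. h \<notin> carrier G \<longrightarrow> f h = 0) \<and>
    (\<lambda>h. (cmod (f h))\<^sup>2) summable_on carrier G}"

definition ell2_inner :: "('g, 'm) monoid_scheme \<Rightarrow> ('g \<Rightarrow> complex) \<Rightarrow> ('g \<Rightarrow> complex) \<Rightarrow> complex"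
  where "ell2_inner G f f' = (\<Sum>\<^sub>\<infinity>h\<in>carrier G. f h * cnj (f' h))"

definition ell2_basis :: "'g \<Rightarrow> 'g \<Rightarrow> complex"
  where "ell2_basis g = (\<lambda>h. if h = g then 1 else 0)"

definition left_regular :: "('g, 'm) monoid_scheme \<Rightarrow> 'g \<Rightarrow> 'g operator"
  where "left_regular G g = (\<lambda>f h. if f \<in> ell2 G \<and> h \<in> carrier G then f (inv\<^bsub>G\<^esub> g \<otimes>\<^bsub>G\<^esub> h) else 0)"

definition op_scale :: "complex \<Rightarrow> 'g operator \<Rightarrow> 'g operator"
  where "op_scale c x = (\<lambda>f h. c * x f h)"

interpretation operator: vector_space op_scale
  by standard (auto simp: op_scale_def fun_eq_iff algebra_simps)

definition is_adjoint :: "('g, 'm) monoid_scheme \<Rightarrow> 'g operator \<Rightarrow> 'g operator \<Rightarrow> bool"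
  where "is_adjoint G x y \<longleftrightarrow>
    (\<forall>f \<in> ell2 G. y f \<in> ell2 G) \<and> (\<forall>f. f \<notin> ell2 G \<longrightarrow> y f = 0) \<and>
    (\<forall>f \<in> ell2 G. \<forall>f' \<in> ell2 G. ell2_inner G (x f) f' = ell2_inner G f (y f'))"

definition adjoint_op :: "('g, 'm) monoid_scheme \<Rightarrow> 'g operator \<Rightarrow> 'g operator"
  where "adjoint_op G x = (THE y. is_adjoint G x y)"

definition group_algebra :: "('g, 'm) monoid_scheme \<Rightarrow> 'g operator set"
  where "group_algebra G = operator.span (left_regular G ` carrier G)"

definition group_trace :: "('g, 'm) monoid_scheme \<Rightarrow> 'g operator \<Rightarrow> complex"
  where "group_trace G x = ell2_inner G (x (ell2_basis \<one>\<^bsub>G\<^esub>)) (ell2_basis \<one>\<^bsub>G\<^esub>)"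

definition L2_inner :: "('g, 'm) monoid_scheme \<Rightarrow> 'g operator \<Rightarrow> 'g operator \<Rightarrow> complex"
  where "L2_inner G x y = group_trace G (adjoint_op G y \<circ> x)"

text \<open>The real part only serves to land in the reals: \<open>\<tau>(x\<^sup>*x) \<ge> 0\<close>.\<close>

definition L2_norm :: "('g, 'm) monoid_scheme \<Rightarrow> 'g operator \<Rightarrow> real"
  where "L2_norm G x = sqrt (Re (group_trace G (adjoint_op G x \<circ> x)))"

definition L2_proj :: "('g, 'm) monoid_scheme \<Rightarrow> 'g operator set \<Rightarrow> 'g operator \<Rightarrow> 'g operator"
  where "L2_proj G V x = (THE v. v \<in> V \<and> (\<forall>w \<in> V. L2_inner G (x - v) w = 0))"

definition homogeneous :: "nat \<Rightarrow> nat \<Rightarrow> gen_word operator set"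
  where "homogeneous n k =
    operator.span (left_regular (free_group n) ` {g \<in> carrier (free_group n). length g = k})"

definition homogeneous_part :: "nat \<Rightarrow> nat \<Rightarrow> gen_word operator \<Rightarrow> gen_word operator"
  where "homogeneous_part n k u = L2_proj (free_group n) (homogeneous n k) u"


section \<open>The orthogonal decomposition\<close>

text \<open>The descriptions \<^const>\<open>adjoint_op\<close> and \<^const>\<open>L2_proj\<close> are well defined on the group algebra, the
  vector state \<^const>\<open>group_trace\<close> satisfies \<open>\<tau>(\<lambda>\<^sub>g) = \<delta>\<^sub>g\<^sub>,\<^sub>e\<close>, and a trace-zero element is the finite sum
  of its homogeneous parts of degree \<open>k \<ge> 1\<close>. In particular the infinite sums over \<open>k\<close> of
  \<open>\<parallel>u\<^sub>k\<parallel>\<^sub>2\<^sup>2\<close> and its multiples have finitely many nonzero terms.\<close>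

lemma op_sum_apply: "(\<Sum>a\<in>T. F a) f h = (\<Sum>a\<in>T. F a f (h::'g)::complex)"
  by (induction T rule: infinite_finite_induct) auto

context group begin

lemma ell2_summable_mult:
  assumes "f \<in> ell2 G" "f' \<in> ell2 G"
  shows "(\<lambda>h. f h * cnj (f' h)) summable_on carrier G"
proof (rule abs_summable_summable, rule abs_summable_on_comparison_test')
  show "(\<lambda>h. (cmod (f h))\<^sup>2 + (cmod (f' h))\<^sup>2) summable_on carrier G"
    using assms by (intro summable_on_add) (auto simp: ell2_def)
  fix h
  have "0 \<le> cmod (f h) * cmod (f' h)"
    by simp
  then show "cmod (f h * cnj (f' h)) \<le> (cmod (f h))\<^sup>2 + (cmod (f' h))\<^sup>2"
    using sum_squares_bound[of "cmod (f h)" "cmod (f' h)"] unfolding norm_mult complex_mod_cnj by linarith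
qed

lemma ell2_finite: "finite T \<Longrightarrow> T \<subseteq> carrier G \<Longrightarrow> (\<And>h. h \<notin> T \<Longrightarrow> f h = 0) \<Longrightarrow> f \<in> ell2 G"
  unfolding ell2_def
  by (auto intro!: summable_on_cong_neutral[THEN iffD1, OF _ _ _ summable_on_finite[of T "\<lambda>h. (cmod (f h))\<^sup>2"]])

lemma ell2_basis_in: "g \<in> carrier G \<Longrightarrow> ell2_basis g \<in> ell2 G"
  by (rule ell2_finite[of "{g}"]) (auto simp: ell2_basis_def)

lemma ell2_add: "f \<in> ell2 G \<Longrightarrow> f' \<in> ell2 G \<Longrightarrow> f + f' \<in> ell2 G"
proof -
  assume a: "f \<in> ell2 G" "f' \<in> ell2 G"
  have "(\<lambda>h. (cmod (f h + f' h))\<^sup>2) summable_on carrier G"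
  proof (rule summable_on_comparison_test)
    show "(\<lambda>h. 2 * (cmod (f h))\<^sup>2 + 2 * (cmod (f' h))\<^sup>2) summable_on carrier G"
      using a by (intro summable_on_add summable_on_cmult_right) (auto simp: ell2_def)
    fix h
    have "(cmod (f h + f' h))\<^sup>2 \<le> (cmod (f h) + cmod (f' h))\<^sup>2"
      by (intro power_mono norm_triangle_ineq) auto
    also have "\<dots> \<le> 2 * (cmod (f h))\<^sup>2 + 2 * (cmod (f' h))\<^sup>2"
      using sum_squares_bound[of "cmod (f h)" "cmod (f' h)"] by (simp add: power2_sum)
    finally show "(cmod (f h + f' h))\<^sup>2 \<le> 2 * (cmod (f h))\<^sup>2 + 2 * (cmod (f' h))\<^sup>2" .
  qed auto
  with a show ?thesis by (auto simp: ell2_def)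
qed

lemma ell2_cmult: "f \<in> ell2 G \<Longrightarrow> (\<lambda>h. c * f h) \<in> ell2 G"
  by (auto simp: ell2_def norm_mult power_mult_distrib intro: summable_on_cmult_right)

lemma inner_basis: "g \<in> carrier G \<Longrightarrow> ell2_inner G f (ell2_basis g) = f g"
proof -
  assume g: "g \<in> carrier G"
  have "ell2_inner G f (ell2_basis g) = (\<Sum>\<^sub>\<infinity>h\<in>{g}. f h * cnj (ell2_basis g h))"
    unfolding ell2_inner_def using g by (intro infsum_cong_neutral) (auto simp: ell2_basis_def)
  then show ?thesis by (simp add: ell2_basis_def)
qed

lemma inner_cnj: "ell2_inner G f f' = cnj (ell2_inner G f' f)"
  unfolding ell2_inner_def infsum_cnj[symmetric] by (simp add: mult.commute)

lemma group_trace_eq: "group_trace G x = x (ell2_basis \<one>) \<one>"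
  by (simp add: group_trace_def inner_basis)

lemma left_regular_basis:
  "g \<in> carrier G \<Longrightarrow> h \<in> carrier G \<Longrightarrow> left_regular G g (ell2_basis h) = ell2_basis (g \<otimes> h)"
proof
  fix k assume g: "g \<in> carrier G" "h \<in> carrier G"
  have "inv g \<otimes> k = h \<longleftrightarrow> k = g \<otimes> h" if "k \<in> carrier G"
    using g that inv_solve_left'[of h g k] by auto
  then show "left_regular G g (ell2_basis h) k = ell2_basis (g \<otimes> h) k"
    using ell2_basis_in[of h] g by (auto simp: left_regular_def ell2_basis_def[of h] ell2_basis_def[of "g \<otimes> h"])
qed

lemma bij_mult: "g \<in> carrier G \<Longrightarrow> bij_betw (\<lambda>h. g \<otimes> h) (carrier G) (carrier G)"
  by (rule bij_betw_byWitness[where f' = "\<lambda>h. inv g \<otimes> h"]) (auto simp: m_assoc[symmetric])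

lemma left_regular_ell2: "g \<in> carrier G \<Longrightarrow> f \<in> ell2 G \<Longrightarrow> left_regular G g f \<in> ell2 G"
  using summable_on_reindex_bij_betw[OF bij_mult[of "inv g"], of "\<lambda>h. (cmod (f h))\<^sup>2"]
  by (auto simp: ell2_def left_regular_def cong: summable_on_cong)

lemma is_adjoint_left_regular:
  assumes g: "g \<in> carrier G"
  shows "is_adjoint G (left_regular G g) (left_regular G (inv g))"
proof -
  have "ell2_inner G (left_regular G g f) f' = ell2_inner G f (left_regular G (inv g) f')"
    if f: "f \<in> ell2 G" "f' \<in> ell2 G" for f f'
  proof -
    have "ell2_inner G f (left_regular G (inv g) f') = (\<Sum>\<^sub>\<infinity>h\<in>carrier G. f h * cnj (f' (g \<otimes> h)))"
      unfolding ell2_inner_def using g f by (intro infsum_cong) (auto simp: left_regular_def)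
    also have "\<dots> = (\<Sum>\<^sub>\<infinity>h\<in>carrier G. f (inv g \<otimes> (g \<otimes> h)) * cnj (f' (g \<otimes> h)))"
      using g by (intro infsum_cong) (auto simp: m_assoc[symmetric])
    also have "\<dots> = (\<Sum>\<^sub>\<infinity>h\<in>carrier G. f (inv g \<otimes> h) * cnj (f' h))"
      by (rule infsum_reindex_bij_betw[OF bij_mult[OF g]])
    also have "\<dots> = ell2_inner G (left_regular G g f) f'"
      unfolding ell2_inner_def using g f by (intro infsum_cong) (auto simp: left_regular_def)
    finally show ?thesis by simp
  qed
  then show ?thesis
    using g by (auto simp: is_adjoint_def left_regular_ell2) (auto simp: left_regular_def fun_eq_iff)
qed

lemma is_adjoint_unique: "is_adjoint G x y \<Longrightarrow> is_adjoint G x y' \<Longrightarrow> y = y'"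
proof
  fix f assume y: "is_adjoint G x y" "is_adjoint G x y'"
  show "y f = y' f"
  proof (cases "f \<in> ell2 G")
    case True
    show ?thesis
    proof
      fix h show "y f h = y' f h"
      proof (cases "h \<in> carrier G")
        case h: True
        have "ell2_inner G (ell2_basis h) (y f) = ell2_inner G (ell2_basis h) (y' f)"
          using y True ell2_basis_in[OF h] unfolding is_adjoint_def by metis
        then have "ell2_inner G (y f) (ell2_basis h) = ell2_inner G (y' f) (ell2_basis h)"
          by (metis inner_cnj)
        then show ?thesis using h by (simp add: inner_basis)
      qed (use y True in \<open>auto simp: is_adjoint_def ell2_def\<close>)
    qed
  qed (use y in \<open>auto simp: is_adjoint_def\<close>)
qed

lemma adjoint_op_eq: "is_adjoint G x y \<Longrightarrow> adjoint_op G x = y"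
  unfolding adjoint_op_def using is_adjoint_unique by blast

definition adjointable :: "'a operator \<Rightarrow> bool"
  where "adjointable x \<longleftrightarrow> (\<forall>f\<in>ell2 G. x f \<in> ell2 G) \<and> (\<exists>y. is_adjoint G x y)"

lemma adjointable_span: "x \<in> group_algebra G \<Longrightarrow> adjointable x"
  unfolding group_algebra_def
proof (induction rule: operator.span_induct_alt)
  case base
  have "is_adjoint G 0 0" by (auto simp: is_adjoint_def ell2_inner_def ell2_def)
  then have "\<exists>y. is_adjoint G 0 y" by blast
  then show ?case unfolding adjointable_def by (simp add: ell2_def)
next
  case (step c x z)
  then obtain g where g: "g \<in> carrier G" "x = left_regular G g" by auto
  then have x: "is_adjoint G x (left_regular G (inv g))" "\<forall>f\<in>ell2 G. x f \<in> ell2 G"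
    using is_adjoint_left_regular left_regular_ell2 by auto
  obtain y where y: "is_adjoint G z y" "\<forall>f\<in>ell2 G. z f \<in> ell2 G" using step by (auto simp: adjointable_def)
  let ?x = "left_regular G (inv g)"
  have "is_adjoint G (op_scale c x + z) (op_scale (cnj c) ?x + y)"
    unfolding is_adjoint_def
  proof (intro conjI ballI allI impI)
    show "(op_scale (cnj c) ?x + y) f \<in> ell2 G" if "f \<in> ell2 G" for f
      using that x(1) y(1)
      by (subst plus_fun_apply, intro ell2_add) (auto simp: op_scale_def is_adjoint_def intro!: ell2_cmult)
    show "(op_scale (cnj c) ?x + y) f = 0" if "f \<notin> ell2 G" for f
      using that x(1) y(1) by (auto simp: op_scale_def is_adjoint_def fun_eq_iff)
    fix f f' assume f: "f \<in> ell2 G" "f' \<in> ell2 G"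
    have "ell2_inner G ((op_scale c x + z) f) f' =
      (\<Sum>\<^sub>\<infinity>h\<in>carrier G. c * (x f h * cnj (f' h)) + z f h * cnj (f' h))"
      unfolding ell2_inner_def by (simp add: op_scale_def algebra_simps)
    also have "\<dots> = c * ell2_inner G (x f) f' + ell2_inner G (z f) f'"
      unfolding ell2_inner_def using f x y
      by (subst infsum_add) (auto intro!: ell2_summable_mult summable_on_cmult_right simp: infsum_cmult_right')
    also have "\<dots> = c * ell2_inner G f (?x f') + ell2_inner G f (y f')"
      using x y f by (auto simp: is_adjoint_def)
    also have "\<dots> = (\<Sum>\<^sub>\<infinity>h\<in>carrier G. c * (f h * cnj (?x f' h)) + f h * cnj (y f' h))"
      unfolding ell2_inner_def using f x y
      by (subst infsum_add) (auto intro!: ell2_summable_mult summable_on_cmult_right simp: infsum_cmult_right' is_adjoint_def)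
    also have "\<dots> = ell2_inner G f ((op_scale (cnj c) ?x + y) f')"
      unfolding ell2_inner_def by (simp add: op_scale_def algebra_simps)
    finally show "ell2_inner G ((op_scale c x + z) f) f' = ell2_inner G f ((op_scale (cnj c) ?x + y) f')" .
  qed
  moreover have "\<forall>f\<in>ell2 G. (op_scale c x + z) f \<in> ell2 G"
    using x y by (intro ballI, subst plus_fun_apply, intro ell2_add) (auto simp: op_scale_def intro!: ell2_cmult)
  ultimately show ?case unfolding adjointable_def by blast
qed

lemma adjoint_op_is: "x \<in> group_algebra G \<Longrightarrow> is_adjoint G x (adjoint_op G x)"
  using adjointable_span adjoint_op_eq by (auto simp: adjointable_def)

lemma L2_inner_eq:
  assumes x: "\<forall>f\<in>ell2 G. x f \<in> ell2 G" and y: "y \<in> group_algebra G"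
  shows "L2_inner G x y = ell2_inner G (x (ell2_basis \<one>)) (y (ell2_basis \<one>))"
proof -
  note e = ell2_basis_in[OF one_closed]
  have "L2_inner G x y = ell2_inner G (adjoint_op G y (x (ell2_basis \<one>))) (ell2_basis \<one>)"
    by (simp add: L2_inner_def group_trace_def)
  also have "\<dots> = cnj (ell2_inner G (ell2_basis \<one>) (adjoint_op G y (x (ell2_basis \<one>))))"
    by (rule inner_cnj)
  also have "\<dots> = cnj (ell2_inner G (y (ell2_basis \<one>)) (x (ell2_basis \<one>)))"
    using adjoint_op_is[OF y] x e by (auto simp: is_adjoint_def)
  finally show ?thesis by (metis inner_cnj)
qed

lemma group_trace_left_regular:
  "g \<in> carrier G \<Longrightarrow> group_trace G (left_regular G g) = (if g = \<one> then 1 else 0)"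
  by (simp add: group_trace_eq left_regular_basis) (auto simp: ell2_basis_def)

abbreviation op_coeff :: "'a operator \<Rightarrow> 'a \<Rightarrow> complex"
  where "op_coeff x g \<equiv> x (ell2_basis \<one>) g"

lemma span_coeff:
  assumes "A \<subseteq> carrier G" "x \<in> operator.span (left_regular G ` A)"
  shows "finite {g. op_coeff x g \<noteq> 0} \<and> {g. op_coeff x g \<noteq> 0} \<subseteq> A \<and>
    x = (\<Sum>g | op_coeff x g \<noteq> 0. op_scale (op_coeff x g) (left_regular G g))"
  using assms(2)
proof (induction rule: operator.span_induct_alt)
  case base then show ?case by simp
next
  case (step c x z)
  then obtain g where g: "g \<in> A" "x = left_regular G g" by auto
  let ?S = "insert g {g. op_coeff z g \<noteq> 0}"
  let ?w = "op_scale c x + z"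
  have cx: "op_coeff x h = (if h = g then 1 else 0)" for h
    using g assms by (subst g, subst left_regular_basis) (auto simp: ell2_basis_def)
  have cw: "op_coeff ?w h = (if h = g then c else 0) + op_coeff z h" for h
    by (simp add: op_scale_def cx)
  have sub: "{g. op_coeff ?w g \<noteq> 0} \<subseteq> ?S" unfolding cw by auto
  have zfin: "finite {g. op_coeff z g \<noteq> 0}" and zA: "{g. op_coeff z g \<noteq> 0} \<subseteq> A"
    and z: "z = (\<Sum>g | op_coeff z g \<noteq> 0. op_scale (op_coeff z g) (left_regular G g))"
    using step.IH by blast+
  have fin: "finite ?S" using zfin by simp
  have "(\<Sum>h | op_coeff ?w h \<noteq> 0. op_scale (op_coeff ?w h) (left_regular G h))
     = (\<Sum>h\<in>?S. op_scale (op_coeff ?w h) (left_regular G h))"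
    using sub fin by (intro sum.mono_neutral_left) auto
  also have "\<dots> = (\<Sum>h\<in>?S. op_scale (if h = g then c else 0) (left_regular G h))
      + (\<Sum>h\<in>?S. op_scale (op_coeff z h) (left_regular G h))"
    unfolding cw operator.scale_left_distrib sum.distrib ..
  also have "(\<Sum>h\<in>?S. op_scale (if h = g then c else 0) (left_regular G h)) = op_scale c x"
    using fin g by (subst sum.mono_neutral_right[of _ "{g}"]) auto
  also have "(\<Sum>h\<in>?S. op_scale (op_coeff z h) (left_regular G h))
      = (\<Sum>h | op_coeff z h \<noteq> 0. op_scale (op_coeff z h) (left_regular G h))"
    using fin by (intro sum.mono_neutral_right) auto
  also have "\<dots> = z" by (rule z[symmetric])
  finally have "?w = (\<Sum>h | op_coeff ?w h \<noteq> 0. op_scale (op_coeff ?w h) (left_regular G h))"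
    by (rule sym)
  moreover have "{g. op_coeff ?w g \<noteq> 0} \<subseteq> A" using sub zA g(1) by blast
  ultimately show ?case using finite_subset[OF sub fin] by blast
qed

lemma span_subset_group_algebra: "A \<subseteq> carrier G \<Longrightarrow> operator.span (left_regular G ` A) \<subseteq> group_algebra G"
  unfolding group_algebra_def by (intro operator.span_mono) auto

lemma coeff_eqI:
  assumes x: "x \<in> group_algebra G" and y: "y \<in> group_algebra G"
    and eq: "\<And>g. g \<in> carrier G \<Longrightarrow> op_coeff x g = op_coeff y g"
  shows "x = y"
proof -
  note c = span_coeff[OF order.refl, folded group_algebra_def]
  have off: "op_coeff z g = 0" if "z \<in> group_algebra G" "g \<notin> carrier G" for z g
    using c[OF that(1), THEN conjunct2, THEN conjunct1] that(2) by blast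
  have eq': "op_coeff x g = op_coeff y g" for g
  proof (cases "g \<in> carrier G")
    case False
    show ?thesis unfolding off[OF x False] off[OF y False] ..
  qed (rule eq)
  have "x = (\<Sum>g | op_coeff x g \<noteq> 0. op_scale (op_coeff x g) (left_regular G g))"
    by (rule c[OF x, THEN conjunct2, THEN conjunct2])
  also have "\<dots> = (\<Sum>g | op_coeff y g \<noteq> 0. op_scale (op_coeff y g) (left_regular G g))"
    unfolding eq' ..
  also have "\<dots> = y"
    by (rule c[OF y, THEN conjunct2, THEN conjunct2, symmetric])
  finally show ?thesis .
qed

lemma L2_proj_coeff:
  assumes A: "A \<subseteq> carrier G" and x: "x \<in> group_algebra G"
  defines "V \<equiv> operator.span (left_regular G ` A)"
  shows "L2_proj G V x \<in> V \<and> (\<forall>g. op_coeff (L2_proj G V x) g = (if g \<in> A then op_coeff x g else 0))"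
proof -
  define D where "D = {g \<in> A. op_coeff x g \<noteq> 0}"
  define v where "v = (\<Sum>g\<in>D. op_scale (op_coeff x g) (left_regular G g))"
  note cx = span_coeff[OF order.refl, folded group_algebra_def, OF x]
  have fD: "finite D" unfolding D_def
    by (rule finite_subset[OF _ cx[THEN conjunct1]]) blast
  have vV: "v \<in> V" unfolding v_def V_def D_def
    by (intro operator.span_sum operator.span_scale operator.span_base) auto
  have cv: "op_coeff v g = (if g \<in> A then op_coeff x g else 0)" for g
  proof -
    have "op_coeff v g = (\<Sum>h\<in>D. op_coeff x h * (if g = h then 1 else 0))"
      unfolding v_def op_sum_apply op_scale_def using A
      by (intro sum.cong refl) (subst left_regular_basis, auto simp: D_def subset_iff ell2_basis_def)
    also have "\<dots> = (if g \<in> D then op_coeff x g else 0)" using fD by (simp add: if_distrib cong: if_cong)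
    finally show ?thesis by (auto simp: D_def)
  qed
  have VA: "V \<subseteq> group_algebra G" unfolding V_def by (rule span_subset_group_algebra[OF A])
  have diff: "x - w \<in> group_algebra G" if "w \<in> V" for w
    using that x VA unfolding group_algebra_def by (intro operator.span_diff) auto
  have inn: "L2_inner G (x - w) z = ell2_inner G ((x - w) (ell2_basis \<one>)) (z (ell2_basis \<one>))"
    if "w \<in> V" "z \<in> V" for w z
  proof (rule L2_inner_eq)
    show "\<forall>f\<in>ell2 G. (x - w) f \<in> ell2 G"
      using adjointable_span[OF diff[OF that(1)]] unfolding adjointable_def by blast
  qed (use that VA in auto)
  have "L2_proj G V x = v"
    unfolding L2_proj_def
  proof (rule the_equality, intro conjI ballI)
    show "v \<in> V" by fact
    show "L2_inner G (x - v) w = 0" if "w \<in> V" for w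
      unfolding inn[OF vV that] ell2_inner_def
    proof (rule infsum_0)
      fix h
      have "op_coeff w h = 0" if "h \<notin> A"
        using span_coeff[OF A \<open>w \<in> V\<close>[unfolded V_def], THEN conjunct2, THEN conjunct1] that by blast
      then show "op_coeff (x - v) h * cnj (op_coeff w h) = 0"
        using cv[of h] by auto
    qed
    fix v' assume v': "v' \<in> V \<and> (\<forall>w\<in>V. L2_inner G (x - v') w = 0)"
    show "v' = v"
    proof (rule coeff_eqI)
      fix g assume g: "g \<in> carrier G"
      show "op_coeff v' g = op_coeff v g"
      proof (cases "g \<in> A")
        case True
        have lg: "left_regular G g \<in> V" unfolding V_def using True by (intro operator.span_base) auto
        have "0 = L2_inner G (x - v') (left_regular G g)" using v' lg by auto
        also have "\<dots> = op_coeff (x - v') g"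
          using inn[of v' "left_regular G g"] v' lg g by (simp add: left_regular_basis inner_basis)
        finally show ?thesis using True cv by simp
      next
        case False
        then have "op_coeff v' g = 0"
          using span_coeff[OF A, of v', THEN conjunct2, THEN conjunct1] v' unfolding V_def by blast
        then show ?thesis using cv False by simp
      qed
    qed (use v' vV VA in auto)
  qed
  then show ?thesis using vV cv by simp
qed

end

theorem homogeneous_decomposition:
  assumes u: "u \<in> group_algebra (free_group n)" and tr: "group_trace (free_group n) u = 0"
  shows "finite {k. homogeneous_part n k u \<noteq> 0}"
    and "\<And>k. homogeneous_part n k u \<in> homogeneous n k"
    and "u = (\<Sum>k | k \<ge> 1 \<and> homogeneous_part n k u \<noteq> 0. homogeneous_part n k u)"
proof -
  interpret group "free_group n" by (rule group_free_group)
  let ?G = "free_group n" let ?p = "\<lambda>k. homogeneous_part n k u"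
  let ?c = "\<lambda>x g. x (ell2_basis \<one>\<^bsub>?G\<^esub>) g"
  have *: "?p k \<in> homogeneous n k \<and> (\<forall>g. ?c (?p k) g = (if g \<in> carrier ?G \<and> length g = k then ?c u g else 0))" for k
    unfolding homogeneous_part_def homogeneous_def using L2_proj_coeff[OF _ u, of "{g \<in> carrier ?G. length g = k}"] by auto
  then show "\<And>k. ?p k \<in> homogeneous n k" by blast
  have hA: "homogeneous n k \<subseteq> group_algebra ?G" for k
    unfolding homogeneous_def by (rule span_subset_group_algebra) auto
  note cu = span_coeff[OF order.refl, folded group_algebra_def, OF u]
  have pk: "?p k \<in> group_algebra ?G" for k using * hA by blast
  have p0: "?p k = 0" if "\<And>g. length g = k \<Longrightarrow> ?c u g = 0" for k
    using * that by (intro coeff_eqI pk) (auto simp: group_algebra_def operator.span_zero)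
  have "{k. ?p k \<noteq> 0} \<subseteq> length ` {g. ?c u g \<noteq> 0}"
  proof
    fix k assume "k \<in> {k. ?p k \<noteq> 0}"
    then obtain g where "length g = k" "?c u g \<noteq> 0" using p0[of k] by blast
    then show "k \<in> length ` {g. ?c u g \<noteq> 0}" by blast
  qed
  then show fin: "finite {k. ?p k \<noteq> 0}" 
    using finite_subset[OF _ finite_imageI[OF cu[THEN conjunct1]]] by blast
  have "?c u [] = 0" using tr by (simp add: group_trace_eq) (simp add: free_group_def)
  show "u = (\<Sum>k | k \<ge> 1 \<and> ?p k \<noteq> 0. ?p k)"
  proof (rule coeff_eqI[OF u])
    show "(\<Sum>k | k \<ge> 1 \<and> ?p k \<noteq> 0. ?p k) \<in> group_algebra ?G"
      using pk unfolding group_algebra_def by (intro operator.span_sum) auto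
    fix g assume g: "g \<in> carrier ?G"
    have "?c (\<Sum>k | k \<ge> 1 \<and> ?p k \<noteq> 0. ?p k) g = (\<Sum>k | k \<ge> 1 \<and> ?p k \<noteq> 0. if k = length g then ?c u g else 0)"
      unfolding op_sum_apply using * g by (intro sum.cong) auto
    also have "\<dots> = (if length g \<ge> 1 \<and> ?p (length g) \<noteq> 0 then ?c u g else 0)"
      using fin by (subst sum.delta) (auto intro: finite_subset[OF _ fin])
    also have "\<dots> = ?c u g"
    proof -
      have "?c u g = 0" if "?p (length g) = 0"
        using *[of "length g"] g that by (auto dest!: spec[of _ g])
      moreover have "?c u g = 0" if "\<not> length g \<ge> 1"
        using that \<open>?c u [] = 0\<close> by (cases g) auto
      ultimately show ?thesis by auto
    qed
    finally show "?c u g = ?c (\<Sum>k | k \<ge> 1 \<and> ?p k \<noteq> 0. ?p k) g" by simp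
  qed
qed

end

theory Submission
  imports Defs "HOL-Analysis.L2_Norm"
begin

text \<open>Expanding \<open>u\<close> in the \<open>\<lambda>\<^sub>g\<close>, the trace of \<open>u\<^sup>3\<close> is a sum over geodesic triangles
  \<open>g h k = e\<close> in the Cayley tree. Such a triangle is a tripod: \<open>g = a b\<^sup>-\<^sup>1\<close>, \<open>h = b c\<^sup>-\<^sup>1\<close>,
  \<open>k = c a\<^sup>-\<^sup>1\<close> without cancellation. With \<open>M a b\<close> the modulus of the coefficient of \<open>u\<close> at
  \<open>a b\<^sup>-\<^sup>1\<close>, the trace is bounded by the sum of \<open>M a b * M b c * M c a\<close>. The tripods with three
  nontrivial legs contribute at most the cube of the Hilbert-Schmidt norm of \<open>M\<close> on nonempty words,
  which is \<open>Q\<close> since a word of length \<open>k\<close> splits into two nonempty words in \<open>k - 1\<close> ways. If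
  exactly one leg is trivial, two of the three factors are a row and a column of \<open>M\<close>, of norm at
  most \<open>S\<close>; this happens in three ways. Two trivial legs are excluded by \<open>\<tau>(u) = 0\<close>.\<close>

section \<open>Cauchy--Schwarz for triple products\<close>

lemma sum_mult_le_sqrt_sum_squares:
  fixes f g :: "'a \<Rightarrow> real"
  shows "(\<Sum>i\<in>A. f i * g i) \<le> sqrt (\<Sum>i\<in>A. (f i)\<^sup>2) * sqrt (\<Sum>i\<in>A. (g i)\<^sup>2)"
proof -
  have "(\<Sum>i\<in>A. f i * g i) \<le> (\<Sum>i\<in>A. \<bar>f i\<bar> * \<bar>g i\<bar>)"
    by (intro sum_mono) (simp flip: abs_mult)
  also have "\<dots> \<le> sqrt (\<Sum>i\<in>A. (f i)\<^sup>2) * sqrt (\<Sum>i\<in>A. (g i)\<^sup>2)"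
    using L2_set_mult_ineq[of f g A] unfolding L2_set_def .
  finally show ?thesis .
qed

text \<open>Cauchy--Schwarz over the pairs \<open>(a, b)\<close>, between \<open>M\<close> and the
  rank-one matrix \<open>x a * y b\<close>, whose Hilbert-Schmidt norm is the product of the two
  vector norms.\<close>

lemma sum_row_matrix_column_le:
  fixes M :: "'a \<Rightarrow> 'b \<Rightarrow> real" and x :: "'a \<Rightarrow> real" and y :: "'b \<Rightarrow> real"
  shows "(\<Sum>a\<in>A. \<Sum>b\<in>B. x a * M a b * y b)
    \<le> sqrt (\<Sum>a\<in>A. (x a)\<^sup>2) * sqrt (\<Sum>a\<in>A. \<Sum>b\<in>B. (M a b)\<^sup>2) * sqrt (\<Sum>b\<in>B. (y b)\<^sup>2)"
proof -
  have "(\<Sum>a\<in>A. \<Sum>b\<in>B. x a * M a b * y b) = (\<Sum>(a, b)\<in>A \<times> B. M a b * (x a * y b))"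
    by (simp add: sum.cartesian_product mult_ac)
  also have "\<dots> \<le> sqrt (\<Sum>(a, b)\<in>A \<times> B. (M a b)\<^sup>2) * sqrt (\<Sum>(a, b)\<in>A \<times> B. (x a * y b)\<^sup>2)"
    using sum_mult_le_sqrt_sum_squares[of "\<lambda>(a, b). M a b" "\<lambda>(a, b). x a * y b" "A \<times> B"]
    by (simp add: case_prod_unfold)
  also have "(\<Sum>(a, b)\<in>A \<times> B. (x a * y b)\<^sup>2) = (\<Sum>a\<in>A. (x a)\<^sup>2) * (\<Sum>b\<in>B. (y b)\<^sup>2)"
    by (simp add: sum_product sum.cartesian_product power_mult_distrib)
  finally show ?thesis
    by (simp add: real_sqrt_mult sum.cartesian_product mult_ac)
qed

text \<open>For fixed \<open>a\<close>, the inner double sum is \<open>M\<close> between row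
  \<open>a\<close> and column \<open>a\<close>. A second Cauchy--Schwarz over \<open>a\<close>
  suffices, since the squared row norms and the squared column norms both add up to the squared
  Hilbert-Schmidt norm.\<close>

lemma sum_matrix_triangle_le:
  fixes M :: "'a \<Rightarrow> 'a \<Rightarrow> real"
  shows "(\<Sum>a\<in>A. \<Sum>b\<in>A. \<Sum>c\<in>A. M a b * M b c * M c a) \<le> sqrt (\<Sum>a\<in>A. \<Sum>b\<in>A. (M a b)\<^sup>2) ^ 3"
proof -
  let ?N = "\<Sum>a\<in>A. \<Sum>b\<in>A. (M a b)\<^sup>2"
  let ?r = "\<lambda>a. sqrt (\<Sum>b\<in>A. (M a b)\<^sup>2)" and ?k = "\<lambda>a. sqrt (\<Sum>c\<in>A. (M c a)\<^sup>2)"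
  have "(\<Sum>a\<in>A. \<Sum>b\<in>A. \<Sum>c\<in>A. M a b * M b c * M c a) \<le> (\<Sum>a\<in>A. ?r a * sqrt ?N * ?k a)"
    by (intro sum_mono sum_row_matrix_column_le)
  also have "\<dots> = sqrt ?N * (\<Sum>a\<in>A. ?r a * ?k a)"
    by (simp add: sum_distrib_left mult_ac)
  also have "\<dots> \<le> sqrt ?N * (sqrt (\<Sum>a\<in>A. (?r a)\<^sup>2) * sqrt (\<Sum>a\<in>A. (?k a)\<^sup>2))"
    by (intro mult_left_mono sum_mult_le_sqrt_sum_squares real_sqrt_ge_zero sum_nonneg) auto
  also have "(\<Sum>a\<in>A. (?r a)\<^sup>2) = ?N"
    by (simp add: sum_nonneg)
  also have "(\<Sum>a\<in>A. (?k a)\<^sup>2) = ?N"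
    using sum.swap[of "\<lambda>a c. (M c a)\<^sup>2" A A] by (simp add: sum_nonneg)
  finally show ?thesis by (simp add: power3_eq_cube mult_ac)
qed

text \<open>Here \<open>z\<close> plays the trivial leg. As \<open>M z z = 0\<close>, terms with two
  or more indices equal to \<open>z\<close> vanish; those with exactly one form three cyclic copies
  of the same row-matrix-column sum \<open>?E\<close>.\<close>

lemma sum_matrix_triangle_pointed_le:
  fixes M :: "'a \<Rightarrow> 'a \<Rightarrow> real"
  assumes fin: "finite A" and z: "z \<notin> A" "M z z = 0"
    and row: "(\<Sum>b\<in>A. (M z b)\<^sup>2) \<le> S\<^sup>2" and col: "(\<Sum>a\<in>A. (M a z)\<^sup>2) \<le> S\<^sup>2"
    and hs: "(\<Sum>a\<in>A. \<Sum>b\<in>A. (M a b)\<^sup>2) \<le> Q\<^sup>2"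
    and SQ: "S \<ge> 0" "Q \<ge> 0"
  shows "(\<Sum>a\<in>insert z A. \<Sum>b\<in>insert z A. \<Sum>c\<in>insert z A. M a b * M b c * M c a)
    \<le> 3 * S\<^sup>2 * Q + Q ^ 3"
proof -
  let ?E = "\<Sum>a\<in>A. \<Sum>b\<in>A. M z a * M a b * M b z"
  have "(\<Sum>a\<in>insert z A. \<Sum>b\<in>insert z A. \<Sum>c\<in>insert z A. M a b * M b c * M c a)
    = (\<Sum>a\<in>A. \<Sum>b\<in>A. \<Sum>c\<in>A. M a b * M b c * M c a) + ?E
      + (\<Sum>a\<in>A. \<Sum>c\<in>A. M a z * M z c * M c a) + (\<Sum>a\<in>A. \<Sum>b\<in>A. M a b * M b z * M z a)"
    using fin z by (simp add: sum.distrib)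
  also have "(\<Sum>a\<in>A. \<Sum>c\<in>A. M a z * M z c * M c a) = ?E"
    by (subst sum.swap) (simp add: mult_ac)
  also have "(\<Sum>a\<in>A. \<Sum>b\<in>A. M a b * M b z * M z a) = ?E"
    by (simp add: mult_ac)
  finally have eq: "(\<Sum>a\<in>insert z A. \<Sum>b\<in>insert z A. \<Sum>c\<in>insert z A. M a b * M b c * M c a)
    = (\<Sum>a\<in>A. \<Sum>b\<in>A. \<Sum>c\<in>A. M a b * M b c * M c a) + 3 * ?E" by simp
  have hs': "sqrt (\<Sum>a\<in>A. \<Sum>b\<in>A. (M a b)\<^sup>2) \<le> Q"
    using hs SQ by (intro real_le_lsqrt) (auto intro!: sum_nonneg)
  have row': "sqrt (\<Sum>b\<in>A. (M z b)\<^sup>2) \<le> S" and col': "sqrt (\<Sum>a\<in>A. (M a z)\<^sup>2) \<le> S"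
    using row col SQ by (auto intro!: real_le_lsqrt sum_nonneg)
  have "?E \<le> sqrt (\<Sum>b\<in>A. (M z b)\<^sup>2) * sqrt (\<Sum>a\<in>A. \<Sum>b\<in>A. (M a b)\<^sup>2) * sqrt (\<Sum>a\<in>A. (M a z)\<^sup>2)"
    by (rule sum_row_matrix_column_le)
  also have "\<dots> \<le> S * Q * S"
    using hs' row' col' SQ by (intro mult_mono) (auto intro!: sum_nonneg mult_nonneg_nonneg)
  finally have "?E \<le> S\<^sup>2 * Q" by (simp add: power2_eq_square mult_ac)
  moreover have "(\<Sum>a\<in>A. \<Sum>b\<in>A. \<Sum>c\<in>A. M a b * M b c * M c a) \<le> Q ^ 3"
    by (rule order_trans[OF sum_matrix_triangle_le power_mono[OF hs']]) (simp add: sum_nonneg)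
  ultimately show ?thesis unfolding eq by simp
qed


section \<open>Tripods in the free group\<close>

definition inv_word :: "gen_word \<Rightarrow> gen_word"
  where "inv_word w = rev (map inv_letter w)"

lemma inv_word_simps [simp]:
  "inv_word [] = []" "inv_word (x # w) = inv_word w @ [inv_letter x]"
  "inv_word (v @ w) = inv_word w @ inv_word v"
  "inv_word (inv_word w) = w" "length (inv_word w) = length w"
  "inv_word w = [] \<longleftrightarrow> w = []"
  by (simp_all add: inv_word_def rev_map comp_def)

lemma inv_word_inject [simp]: "inv_word v = inv_word w \<longleftrightarrow> v = w"
  by (metis inv_word_simps(4))

lemma inv_free_group:
  assumes "w \<in> carrier (free_group n)"
  shows "inv\<^bsub>free_group n\<^esub> w = inv_word w"
proof -
  interpret group "free_group n" by (rule group_free_group)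
  show ?thesis
  proof (rule inv_equality)
    show "inv_word w \<otimes>\<^bsub>free_group n\<^esub> w = \<one>\<^bsub>free_group n\<^esub>"
      using assms foldr_cons_reduce_inverse[of "[]" w]
      by (simp add: free_group_def foldr_cons_reduce_Nil inv_word_def)
    show "inv_word w \<in> carrier (free_group n)"
      using assms by (fastforce simp: free_group_def reduced_inverse inv_letter_def inv_word_def)
  qed fact
qed

lemma cons_reduce_append: "v \<noteq> [] \<Longrightarrow> reduced (x # v) \<Longrightarrow> cons_reduce x (v @ w) = x # v @ w"
  by (cases v) auto

text \<open>The leg \<open>b\<close> records what \<open>h\<close> loses to cancellation against the
  end of \<open>g\<close>. Prepending a letter to \<open>g\<close> either lengthens \<open>a\<close>
  or cancels one more letter of \<open>h\<close>.\<close>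

lemma tripod:
  assumes "reduced g"
  obtains a b c where "g = a @ inv_word b" "h = b @ inv_word c"
    "foldr cons_reduce g h = a @ inv_word c"
proof -
  have "\<exists>a b c. g = a @ inv_word b \<and> h = b @ inv_word c \<and> foldr cons_reduce g h = a @ inv_word c"
    using assms
  proof (induction g)
    case Nil
    show ?case by (rule exI[of _ "[]"], rule exI[of _ "[]"], rule exI[of _ "inv_word h"]) simp
  next
    case (Cons x g)
    then obtain a b c where IH: "g = a @ inv_word b" "h = b @ inv_word c"
      "foldr cons_reduce g h = a @ inv_word c"
      using reduced_tl by blast
    show ?case
    proof (cases "cons_reduce x (a @ inv_word c) = x # a @ inv_word c")
      case True
      then show ?thesis using IH
        by (intro exI[of _ "x # a"] exI[of _ b] exI[of _ c]) simp
    next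
      case False
      \<comment> \<open>Cancellation at \<open>x\<close> meets the first letter of the product; if
        \<open>a\<close> were nonempty, this letter would follow \<open>x\<close> in the reduced
        word \<open>x # g\<close>.\<close>
      have a: "a = []"
      proof (rule ccontr)
        assume "a \<noteq> []"
        then have "reduced (x # a)"
          using Cons.prems IH(1) by (auto simp: reduced_def successively_append_iff simp flip: append_Cons)
        with False \<open>a \<noteq> []\<close> show False using cons_reduce_append by blast
      qed
      with False obtain w where w: "inv_word c = inv_letter x # w"
        by (cases "inv_word c") (auto split: if_splits)
      have "c = inv_word w @ [x]"
        using arg_cong[OF w, of inv_word] by simp
      \<comment> \<open>The cancelled letter \<open>inv_letter x\<close> of \<open>h\<close> moves
        from the front of \<open>inv_word c\<close> to the end of \<open>b\<close>.\<close>
      with IH a w show ?thesis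
        by (intro exI[of _ "[]"] exI[of _ "b @ [inv_letter x]"] exI[of _ "inv_word w"]) simp
    qed
  qed
  with that show ?thesis by blast
qed

section \<open>Splittings of words and the sum over triangles\<close>

text \<open>A splitting of \<open>g\<close> into two nonempty pieces is determined by its cut
  position in \<open>{1..<length g}\<close>, so each \<open>g\<close> is counted at most
  \<open>length g - 1\<close> times.\<close>

lemma sum_splittings_le:
  fixes F :: "gen_word \<Rightarrow> real"
  assumes fin: "finite A" "finite T" and supp: "\<And>g. F g \<noteq> 0 \<Longrightarrow> g \<in> T" and A: "[] \<notin> A"
  shows "(\<Sum>a\<in>A. \<Sum>b\<in>A. (F (a @ inv_word b))\<^sup>2) \<le> (\<Sum>g\<in>T. real (length g - 1) * (F g)\<^sup>2)"
proof -
  let ?D = "{(a, b). a \<in> A \<and> b \<in> A \<and> a @ inv_word b \<in> T}"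
  have D: "?D \<subseteq> A \<times> A" by auto
  have "(\<Sum>a\<in>A. \<Sum>b\<in>A. (F (a @ inv_word b))\<^sup>2) = (\<Sum>(a, b)\<in>A \<times> A. (F (a @ inv_word b))\<^sup>2)"
    by (rule sum.cartesian_product)
  also have "\<dots> = (\<Sum>(a, b)\<in>?D. (F (a @ inv_word b))\<^sup>2)"
    using fin D supp by (intro sum.mono_neutral_right) auto
  also have "\<dots> \<le> (\<Sum>(g, i)\<in>(SIGMA g:T. {1..<length g}). (F g)\<^sup>2)"
  proof (rule sum_le_included[where i = "\<lambda>(g, i). (take i g, inv_word (drop i g))"])
    show "finite ?D" using fin D finite_subset by blast
    show "\<forall>x\<in>?D. \<exists>y\<in>(SIGMA g:T. {1..<length g}).
        (case y of (g, i) \<Rightarrow> (take i g, inv_word (drop i g))) = x \<and>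
        (case x of (a, b) \<Rightarrow> (F (a @ inv_word b))\<^sup>2) \<le> (case y of (g, i) \<Rightarrow> (F g)\<^sup>2)"
    proof clarify
      fix a b assume "a \<in> A" "b \<in> A" "a @ inv_word b \<in> T"
      moreover from this A have "a \<noteq> []" "b \<noteq> []" by auto
      ultimately show "\<exists>y\<in>(SIGMA g:T. {1..<length g}).
        (case y of (g, i) \<Rightarrow> (take i g, inv_word (drop i g))) = (a, b) \<and>
        (F (a @ inv_word b))\<^sup>2 \<le> (case y of (g, i) \<Rightarrow> (F g)\<^sup>2)"
        by (intro bexI[of _ "(a @ inv_word b, length a)"]) (auto simp: Suc_le_eq)
    qed
  qed (use fin in auto)
  also have "\<dots> = (\<Sum>g\<in>T. real (length g - 1) * (F g)\<^sup>2)"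
    using fin by (subst sum.Sigma[symmetric]) auto
  finally show ?thesis .
qed

theorem sum_triangles_le:
  fixes F :: "gen_word \<Rightarrow> real" and S Q :: real
  assumes fin: "finite T" and T: "\<And>g. g \<in> T \<Longrightarrow> reduced g"
    and F: "\<And>g. F g \<ge> 0" "\<And>g. F g \<noteq> 0 \<Longrightarrow> g \<in> T" "F [] = 0"
    and S: "S \<ge> 0" "S\<^sup>2 = (\<Sum>g\<in>T. (F g)\<^sup>2)"
    and Q: "Q \<ge> 0" "Q\<^sup>2 = (\<Sum>g\<in>T. real (length g - 1) * (F g)\<^sup>2)"
  shows "(\<Sum>g\<in>T. \<Sum>h\<in>T. F g * F h * F (inv_word (foldr cons_reduce g h))) \<le> 3 * S\<^sup>2 * Q + Q ^ 3"
proof -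
  \<comment> \<open>The nonempty prefixes of words in \<open>T\<close>: the legs \<open>a\<close>,
    \<open>b\<close>, \<open>c\<close> of a tripod are prefixes of \<open>g\<close>,
    \<open>h\<close> and the inverse of their product.\<close>
  define P where "P = (\<Union>g\<in>T. (\<lambda>i. take i g) ` {..length g}) - {[]}"
  have finP: "finite P" unfolding P_def using fin by auto
  have inP: "v \<in> insert [] P" if "v @ w \<in> T" for v w
  proof -
    have "v = take (length v) (v @ w)" "length v \<in> {..length (v @ w)}" by auto
    with that show ?thesis unfolding P_def by blast
  qed
  \<comment> \<open>Taken with \<open>inv_word\<close> this bounds the row of the empty word, with
    the identity its column.\<close>
  have word: "(\<Sum>v\<in>P. (F (f v))\<^sup>2) \<le> S\<^sup>2" if "inj f" for f
  proof -
    have "(\<Sum>v\<in>P. (F (f v))\<^sup>2) = (\<Sum>g\<in>f ` P. (F g)\<^sup>2)"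
      using that by (subst sum.reindex) (auto intro: inj_on_subset)
    also have "\<dots> = (\<Sum>g\<in>f ` P \<inter> T. (F g)\<^sup>2)"
      using finP F(2) by (intro sum.mono_neutral_right) auto
    also have "\<dots> \<le> S\<^sup>2" unfolding S using fin by (intro sum_mono2) auto
    finally show ?thesis .
  qed
  let ?M = "\<lambda>a b. F (a @ inv_word b)"
  let ?P = "insert [] P"
  \<comment> \<open>On \<open>?X\<close> the third side also lies in \<open>T\<close>, which puts
    the leg \<open>c\<close> into \<open>?P\<close>; off \<open>?X\<close> the summand is
    zero.\<close>
  let ?X = "{(g, h). g \<in> T \<and> h \<in> T \<and> inv_word (foldr cons_reduce g h) \<in> T}"
  have X: "?X \<subseteq> T \<times> T" by auto
  have "(\<Sum>g\<in>T. \<Sum>h\<in>T. F g * F h * F (inv_word (foldr cons_reduce g h)))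
    = (\<Sum>(g, h)\<in>T \<times> T. F g * F h * F (inv_word (foldr cons_reduce g h)))"
    by (rule sum.cartesian_product)
  also have "\<dots> = (\<Sum>(g, h)\<in>?X. F g * F h * F (inv_word (foldr cons_reduce g h)))"
    using fin X F(2) by (intro sum.mono_neutral_right) auto
  also have "\<dots> \<le> (\<Sum>(a, b, c)\<in>?P \<times> ?P \<times> ?P. ?M a b * ?M b c * ?M c a)"
  \<comment> \<open>A triple of legs determines \<open>(g, h)\<close>, so different pairs use
    different triples; the remaining triples only add nonnegative terms.\<close>
  proof (rule sum_le_included[where i = "\<lambda>(a, b, c). (a @ inv_word b, b @ inv_word c)"])
    show "finite ?X" using fin X finite_subset by blast
    show "\<forall>x\<in>?X. \<exists>y\<in>?P \<times> ?P \<times> ?P.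
        (case y of (a, b, c) \<Rightarrow> (a @ inv_word b, b @ inv_word c)) = x \<and>
        (case x of (g, h) \<Rightarrow> F g * F h * F (inv_word (foldr cons_reduce g h)))
          \<le> (case y of (a, b, c) \<Rightarrow> ?M a b * ?M b c * ?M c a)"
    proof clarify
      fix g h assume gh: "g \<in> T" "h \<in> T" "inv_word (foldr cons_reduce g h) \<in> T"
      obtain a b c where abc: "g = a @ inv_word b" "h = b @ inv_word c"
        "foldr cons_reduce g h = a @ inv_word c"
        using tripod[OF T[OF gh(1)]] by blast
      then have k: "inv_word (foldr cons_reduce g h) = c @ inv_word a" by simp
      have "a \<in> ?P" "b \<in> ?P" "c \<in> ?P"
        by (rule inP[OF gh(1)[unfolded abc(1)]], rule inP[OF gh(2)[unfolded abc(2)]],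
            rule inP[OF gh(3)[unfolded k]])
      then have "(a, b, c) \<in> ?P \<times> ?P \<times> ?P" by blast
      then show "\<exists>y\<in>?P \<times> ?P \<times> ?P.
        (case y of (a, b, c) \<Rightarrow> (a @ inv_word b, b @ inv_word c)) = (g, h) \<and>
        F g * F h * F (inv_word (foldr cons_reduce g h))
          \<le> (case y of (a, b, c) \<Rightarrow> ?M a b * ?M b c * ?M c a)"
        unfolding k by (intro bexI[of _ "(a, b, c)"]) (simp add: abc(1,2), assumption)
    qed
  qed (use finP F(1) in auto)
  also have "\<dots> = (\<Sum>a\<in>?P. \<Sum>b\<in>?P. \<Sum>c\<in>?P. ?M a b * ?M b c * ?M c a)"
    by (simp only: sum.cartesian_product case_prod_unfold)
  also have "\<dots> \<le> 3 * S\<^sup>2 * Q + Q ^ 3"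
  proof (rule sum_matrix_triangle_pointed_le)
    show "[] \<notin> P" by (simp add: P_def)
    then show "(\<Sum>a\<in>P. \<Sum>b\<in>P. (?M a b)\<^sup>2) \<le> Q\<^sup>2"
      unfolding Q using finP fin F(2) by (intro sum_splittings_le) auto
    show "(\<Sum>b\<in>P. (?M [] b)\<^sup>2) \<le> S\<^sup>2"
      using word[of inv_word] by (simp add: inj_def)
    show "(\<Sum>a\<in>P. (?M a [])\<^sup>2) \<le> S\<^sup>2"
      using word[of "\<lambda>v. v"] by simp
  qed (use finP F(3) S(1) Q(1) in auto)
  finally show ?thesis .
qed


section \<open>Coefficients of elements of the group algebra\<close>

context group
begin

lemma group_algebra_ell2: "x \<in> group_algebra G \<Longrightarrow> f \<in> ell2 G \<Longrightarrow> x f \<in> ell2 G"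
  using adjointable_span unfolding adjointable_def by blast

text \<open>The action of \<open>x\<close> is convolution with its finitely many coefficients. A
  general \<open>f\<close> is allowed because powers of \<open>x\<close> need it at \<open>x\<close>
  applied to a vector.\<close>

lemma group_algebra_apply:
  assumes x: "x \<in> group_algebra G" and f: "f \<in> ell2 G" and h: "h \<in> carrier G"
  shows "x f h = (\<Sum>g | op_coeff x g \<noteq> 0. op_coeff x g * f (inv g \<otimes> h))"
proof -
  have "x f h = (\<Sum>g | op_coeff x g \<noteq> 0. op_scale (op_coeff x g) (left_regular G g)) f h"
    using span_coeff[OF order.refl, folded group_algebra_def, OF x] by metis
  then show ?thesis
    unfolding op_sum_apply using f h by (simp add: op_scale_def left_regular_def)
qed

lemma group_trace_cube:
  assumes x: "x \<in> group_algebra G"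
  shows "group_trace G (x ^^ 3) = (\<Sum>g | op_coeff x g \<noteq> 0. \<Sum>h | op_coeff x h \<noteq> 0.
    op_coeff x g * op_coeff x h * op_coeff x (inv (g \<otimes> h)))"
proof -
  let ?e = "ell2_basis \<one>"
  have e: "?e \<in> ell2 G" "x ?e \<in> ell2 G" "x (x ?e) \<in> ell2 G"
    by (intro group_algebra_ell2[OF x] ell2_basis_in one_closed)+
  have supp: "{g. op_coeff x g \<noteq> 0} \<subseteq> carrier G"
    using span_coeff[OF order.refl, folded group_algebra_def, OF x] by blast
  have "group_trace G (x ^^ 3) = x (x (x ?e)) \<one>"
    by (simp add: group_trace_eq numeral_3_eq_3)
  also have "\<dots> = (\<Sum>g | op_coeff x g \<noteq> 0. op_coeff x g * x (x ?e) (inv g))"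
    using supp by (subst group_algebra_apply[OF x e(3)]) (auto intro!: sum.cong)
  also have "\<dots> = (\<Sum>g | op_coeff x g \<noteq> 0. \<Sum>h | op_coeff x h \<noteq> 0.
    op_coeff x g * op_coeff x h * op_coeff x (inv (g \<otimes> h)))"
  proof (intro sum.cong refl)
    fix g assume "g \<in> {g. op_coeff x g \<noteq> 0}"
    then have g: "g \<in> carrier G" using supp by blast
    show "op_coeff x g * x (x ?e) (inv g) = (\<Sum>h | op_coeff x h \<noteq> 0.
        op_coeff x g * op_coeff x h * op_coeff x (inv (g \<otimes> h)))"
      unfolding group_algebra_apply[OF x e(2) inv_closed[OF g]] sum_distrib_left
    proof (intro sum.cong refl)
      fix h assume "h \<in> {h. op_coeff x h \<noteq> 0}"
      then have "h \<in> carrier G" using supp by blast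
      with g show "op_coeff x g * (op_coeff x h * op_coeff x (inv h \<otimes> inv g))
        = op_coeff x g * op_coeff x h * op_coeff x (inv (g \<otimes> h))"
        by (simp add: inv_mult_group)
    qed
  qed
  finally show ?thesis .
qed

text \<open>Parseval: the trace of \<open>adjoint_op G x \<circ> x\<close> is the squared norm of
  the vector \<open>x (ell2_basis \<one>)\<close>, whose entries are the coefficients.\<close>

lemma L2_norm_squared:
  assumes x: "x \<in> group_algebra G"
    and T: "finite T" "\<And>g. op_coeff x g \<noteq> 0 \<Longrightarrow> g \<in> T" "T \<subseteq> carrier G"
  shows "(L2_norm G x)\<^sup>2 = (\<Sum>g\<in>T. (cmod (op_coeff x g))\<^sup>2)"
proof -
  let ?e = "ell2_basis \<one>"
  have "group_trace G (adjoint_op G x \<circ> x) = ell2_inner G (x ?e) (x ?e)"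
    using L2_inner_eq[of x x] x group_algebra_ell2 by (simp add: L2_inner_def)
  also have "\<dots> = (\<Sum>\<^sub>\<infinity>g\<in>T. op_coeff x g * cnj (op_coeff x g))"
    unfolding ell2_inner_def using T by (intro infsum_cong_neutral) auto
  also have "\<dots> = of_real (\<Sum>g\<in>T. (cmod (op_coeff x g))\<^sup>2)"
    using T by (simp add: complex_norm_square[symmetric])
  finally show ?thesis
    unfolding L2_norm_def by (simp add: sum_nonneg)
qed

end

section \<open>Norms of homogeneous parts in terms of coefficients\<close>

lemma homogeneous_part_coeff:
  fixes n k :: nat
  defines "G \<equiv> free_group n"
  assumes u: "u \<in> group_algebra G"
  shows "homogeneous_part n k u \<in> group_algebra G"
    and "homogeneous_part n k u (ell2_basis []) g = (if length g = k then u (ell2_basis []) g else 0)"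
proof -
  interpret group G unfolding G_def by (rule group_free_group)
  have one: "\<one>\<^bsub>G\<^esub> = []" by (simp add: G_def free_group_def)
  let ?A = "{g \<in> carrier G. length g = k}"
  note p = L2_proj_coeff[of ?A, OF _ u, folded homogeneous_def[of n k, folded G_def]
      homogeneous_part_def[of n k, folded G_def], unfolded one]
  have "homogeneous n k \<subseteq> group_algebra G"
    unfolding homogeneous_def G_def[symmetric] by (rule span_subset_group_algebra) auto
  with p show "homogeneous_part n k u \<in> group_algebra G" by blast
  have "u (ell2_basis []) g = 0" if "g \<notin> carrier G"
    using span_coeff[OF order.refl, folded group_algebra_def, OF u, unfolded one] that by blast
  then show "homogeneous_part n k u (ell2_basis []) g
      = (if length g = k then u (ell2_basis []) g else 0)"
    using p by auto
qed

text \<open>Groups the support of \<open>u\<close> by word length. The weight \<open>1\<close>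
  yields the formula for \<open>S\<close> and the weight \<open>k - 1\<close> that for
  \<open>Q\<close>.\<close>

lemma infsum_weighted_L2_norm:
  fixes n :: nat and w :: "nat \<Rightarrow> real"
  defines "G \<equiv> free_group n"
  assumes u: "u \<in> group_algebra G" and tr: "group_trace G u = 0"
  shows "(\<Sum>\<^sub>\<infinity>k\<in>{1..}. w k * (L2_norm G (homogeneous_part n k u))\<^sup>2)
    = (\<Sum>g | u (ell2_basis []) g \<noteq> 0. w (length g) * (cmod (u (ell2_basis []) g))\<^sup>2)"
proof -
  interpret group G unfolding G_def by (rule group_free_group)
  have one: "\<one>\<^bsub>G\<^esub> = []" by (simp add: G_def free_group_def)
  let ?c = "u (ell2_basis [])"
  let ?T = "{g. ?c g \<noteq> 0}"
  have T: "finite ?T" "?T \<subseteq> carrier G"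
    using span_coeff[OF order.refl, folded group_algebra_def, OF u, unfolded one] by blast+
  have "?c [] = 0" using tr by (simp add: group_trace_eq one)
  \<comment> \<open>The coefficient at the empty word is the trace, so starting the sum at
    \<open>1\<close> loses nothing.\<close>
  then have pos: "length ` ?T \<subseteq> {1..}"
    by (auto simp: Suc_le_eq)
  note p = homogeneous_part_coeff[of u n, folded G_def, OF u]
  have b: "(L2_norm G (homogeneous_part n k u))\<^sup>2 = (\<Sum>g\<in>{g \<in> ?T. length g = k}. (cmod (?c g))\<^sup>2)" for k
  proof -
    have "(L2_norm G (homogeneous_part n k u))\<^sup>2
      = (\<Sum>g\<in>{g \<in> ?T. length g = k}. (cmod (if length g = k then ?c g else 0))\<^sup>2)"
      by (rule L2_norm_squared[OF p(1), unfolded one p(2)]) (use T in \<open>auto split: if_splits\<close>)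
    then show ?thesis by simp
  qed
  have "(\<Sum>\<^sub>\<infinity>k\<in>{1..}. w k * (L2_norm G (homogeneous_part n k u))\<^sup>2)
    = (\<Sum>\<^sub>\<infinity>k\<in>length ` ?T. w k * (L2_norm G (homogeneous_part n k u))\<^sup>2)"
    unfolding b using pos by (intro infsum_cong_neutral) (auto intro!: sum.neutral)
  also have "\<dots> = (\<Sum>k\<in>length ` ?T. \<Sum>g\<in>{g \<in> ?T. length g = k}. w (length g) * (cmod (?c g))\<^sup>2)"
    using T by (simp add: b sum_distrib_left)
  also have "\<dots> = (\<Sum>g\<in>?T. w (length g) * (cmod (?c g))\<^sup>2)"
    using T by (intro sum.group) auto
  finally show ?thesis .
qed

theorem proposition2p2:
  fixes n :: nat and u :: "gen_word operator" and b :: "nat \<Rightarrow> real" and S Q :: real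
  assumes "n \<ge> 2"
    and "u \<in> group_algebra (free_group n)"
    and "u = adjoint_op (free_group n) u"
    and "group_trace (free_group n) u = 0"
    and "\<And>k. b k = L2_norm (free_group n) (homogeneous_part n k u)"
    and "S \<ge> 0" and "Q \<ge> 0"
    and "S\<^sup>2 = (\<Sum>\<^sub>\<infinity>k\<in>{1..}. (b k)\<^sup>2)"
    and "Q\<^sup>2 = (\<Sum>\<^sub>\<infinity>k\<in>{1..}. (real k - 1) * (b k)\<^sup>2)"
  shows "cmod (group_trace (free_group n) (u ^^ 3)) \<le> 3 * S\<^sup>2 * Q + Q ^ 3"
proof -
  let ?G = "free_group n" let ?c = "u (ell2_basis [])"
  let ?T = "{g. ?c g \<noteq> 0}"
  note u = assms(2) and tr = assms(4)
  interpret group ?G by (rule group_free_group)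
  have one: "\<one>\<^bsub>?G\<^esub> = []" and mult: "\<And>g h. g \<otimes>\<^bsub>?G\<^esub> h = foldr cons_reduce g h"
    by (simp_all add: free_group_def)
  have T: "finite ?T" "?T \<subseteq> carrier ?G"
    using span_coeff[OF order.refl, folded group_algebra_def, OF u, unfolded one] by blast+
  have c0: "?c [] = 0" using tr by (simp add: group_trace_eq one)
  have S: "S\<^sup>2 = (\<Sum>g\<in>?T. (cmod (?c g))\<^sup>2)"
    using infsum_weighted_L2_norm[OF u tr, of "\<lambda>_. 1"] assms(5,8) by simp
  have "Q\<^sup>2 = (\<Sum>g\<in>?T. (real (length g) - 1) * (cmod (?c g))\<^sup>2)"
    using infsum_weighted_L2_norm[OF u tr, of "\<lambda>k. real k - 1"] assms(5,9) by simp
  \<comment> \<open>Real and truncated subtraction differ only at the empty word, which trace zero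
    keeps out of the support.\<close>
  also have "\<dots> = (\<Sum>g\<in>?T. real (length g - 1) * (cmod (?c g))\<^sup>2)"
  proof (intro sum.cong refl)
    fix g assume "g \<in> ?T"
    then have "g \<noteq> []" using c0 by auto
    then show "(real (length g) - 1) * (cmod (?c g))\<^sup>2 = real (length g - 1) * (cmod (?c g))\<^sup>2"
      by (cases g) auto
  qed
  finally have Q: "Q\<^sup>2 = (\<Sum>g\<in>?T. real (length g - 1) * (cmod (?c g))\<^sup>2)" .
  have "cmod (group_trace ?G (u ^^ 3))
    = cmod (\<Sum>g\<in>?T. \<Sum>h\<in>?T. ?c g * ?c h * ?c (inv\<^bsub>?G\<^esub> (g \<otimes>\<^bsub>?G\<^esub> h)))"
    by (simp only: group_trace_cube[OF u] one)
  also have "\<dots> \<le> (\<Sum>g\<in>?T. \<Sum>h\<in>?T. cmod (?c g * ?c h * ?c (inv\<^bsub>?G\<^esub> (g \<otimes>\<^bsub>?G\<^esub> h))))"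
    by (intro sum_norm_le norm_sum)
  also have "\<dots> = (\<Sum>g\<in>?T. \<Sum>h\<in>?T. cmod (?c g) * cmod (?c h) * cmod (?c (inv_word (foldr cons_reduce g h))))"
  proof (intro sum.cong refl)
    fix g h assume "g \<in> ?T" "h \<in> ?T"
    then have "g \<otimes>\<^bsub>?G\<^esub> h \<in> carrier ?G" using T by blast
    then show "cmod (?c g * ?c h * ?c (inv\<^bsub>?G\<^esub> (g \<otimes>\<^bsub>?G\<^esub> h)))
        = cmod (?c g) * cmod (?c h) * cmod (?c (inv_word (foldr cons_reduce g h)))"
      by (simp only: inv_free_group norm_mult mult)
  qed
  also have "\<dots> \<le> 3 * S\<^sup>2 * Q + Q ^ 3"
  \<comment> \<open>Here \<open>F\<close> is the modulus of the coefficient and \<open>T\<close> the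
    support of \<open>u\<close>.\<close>
  proof (rule sum_triangles_le[OF T(1)])
    show "reduced g" if "g \<in> ?T" for g
      using that T(2) by (auto simp: free_group_def)
  qed (use S Q c0 assms(6,7) in auto)
  finally show ?thesis .
qed

end
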